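(* Let $p\ge 2$ and suppose $z(t)\in L^p(\Omega,\mathbb P)$ for every $t\in[0,T]$ and $\int_0^T \mathbb E[|z(t)|^p]^{2/p}\,dt<+\infty$. Let $F:[0,T]\times\mathbb R\to\mathbb R$ satisfy: (i) $F(t,\xi)\ge 0$ for all $(t,\xi)$; (ii) $F(t,\xi)$ is twice continuously differentiable in $\xi$ and $\frac{\partial F}{\partial \xi}$, $\frac{\partial^2 F}{\partial \xi^2}$ are continuous functions of both variables; (iii) there exist $\alpha\in(0,p)$ and a non-negative $L\in L^1(0,T)$ such that $|F(t,\xi)|+\left|\frac{\partial F}{\partial \xi}(t,\xi)\right|+\left|\frac{\partial^2 F}{\partial \xi^2}(t,\xi)\right|\le L(t)(1+|\xi|^\alpha)$ for all $t\in[0,T]$, $\xi\in\mathbb R$; (iv) for every fixed $t\in[0,T]$ the function $\xi\mapsto F(t,\xi)$ is convex. Let $\Psi\in\Delta_2$ be a Young function and, for each $\delta>0$, let $\overline u_{\delta,\Psi}\in L^1(0,T)$ be a minimizer of $J_{\delta,\Psi}$ over $L^1(0,T)$. Then $\{\overline u_{\delta,\Psi}\}_{\delta>0}$ is a minimizing family for $J$: for every $\varepsilon>0$ there exists $\delta_0>0$ such that for all $\delta\in(0,\delta_0)$ $$m\le J[\overline u_{\delta,\Psi}]\le m+\varepsilon,\qquad m=\inf_{u\in L^1(0,T)}J[u].$$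
   Context: Fix $T>0$, a filtered probability space $(\Omega,\mathcal F,(\mathcal F_t)_{t\ge 0},\mathbb P)$ and an $\mathcal F_t$-Brownian motion $W$ (started at $0$). $a:[0,T]\to\mathbb R$ is a deterministic function in $L^\infty(0,T)$, $A(t)=\int_0^t a(s)\,ds$, $G(t)=e^{W(t)-t/2}$. $z$ is a real $\mathcal F_t$-adapted, jointly measurable process; $F$ is Borel measurable. $L^1(0,T)$ denotes deterministic integrable real functions (identified when equal a.e.). For $u\in L^1(0,T)$ put $$\xi_u(t)=G(t)e^{A(t)}\int_0^t\frac{e^{-A(s)}}{G(s)}(z(s)-u(s))\,ds,\qquad J[u]=\mathbb E\left[\int_0^T F(t,\xi_u(t))\,dt\right].$$ A Young function is a function $\Psi:[0,+\infty)\to[0,+\infty)$ of the form $\Psi(t)=\int_0^t\psi(s)\,ds$ with $\psi:[0,+\infty)\to[0,+\infty)$, $\psi(0)=0$, $\psi(s)>0$ for $s>0$, $\psi$ right-continuous, non-decreasing, and $\lim_{s\to+\infty}\psi(s)=+\infty$. $\Psi\in\Delta_2$ means there is $k>0$ with $\Psi(2t)\le k\Psi(t)$ for all $t\ge0$. For $u\in L^1(0,T)$ and $\delta>0$, $\mathcal F_\Psi[u]=\int_0^T\Psi(|u(t)|)\,dt\in[0,+\infty]$ and $J_{\delta,\Psi}[u]=J[u]+\delta\,\mathcal F_\Psi[u]$. Under the hypotheses of the claim a minimizer of $J_{\delta,\Psi}$ exists for every $\delta>0$. *)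

theory Defs
  imports "HOL-Probability.Probability"
begin

text \<open>Time is real-valued, but only nonnegative indices of the filtration are used; the library's
  \<^locale>\<open>filtration\<close> quantifies over the whole index type, hence the \<open>max 0\<close>. The usual conditions
  (completeness, right-continuity) are not required.\<close>

definition filtered_prob_space :: "'a measure \<Rightarrow> (real \<Rightarrow> 'a measure) \<Rightarrow> bool" where
  "filtered_prob_space M \<F> \<longleftrightarrow>
     prob_space M \<and>
     filtration (space M) (\<lambda>t. \<F> (max 0 t)) \<and>
     (\<forall>t\<ge>0. subalgebra M (\<F> t))"

definition brownian_motion ::
    "'a measure \<Rightarrow> (real \<Rightarrow> 'a measure) \<Rightarrow> (real \<Rightarrow> 'a \<Rightarrow> real) \<Rightarrow> bool" where
  "brownian_motion M \<F> W \<longleftrightarrow>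
     (\<forall>t\<ge>0. W t \<in> borel_measurable (\<F> t)) \<and>
     (AE \<omega> in M. W 0 \<omega> = 0) \<and>
     (AE \<omega> in M. continuous_on {0..} (\<lambda>t. W t \<omega>)) \<and>
     (\<forall>s t. 0 \<le> s \<and> s < t \<longrightarrow>
        distributed M lborel (\<lambda>\<omega>. W t \<omega> - W s \<omega>) (normal_density 0 (sqrt (t - s))) \<and>
        prob_space.indep_set M (sets (\<F> s))
          (sets (vimage_algebra (space M) (\<lambda>\<omega>. W t \<omega> - W s \<omega>) borel)))"

text \<open>Elements of the space are functions, not classes modulo a.e. equality; values outside
  \<open>[0,T]\<close> are irrelevant. Working with Borel representatives loses nothing, since every Lebesgue
  integrable function agrees a.e. with a Borel one.\<close>

definition L1_space :: "real \<Rightarrow> (real \<Rightarrow> real) set" where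
  "L1_space T = {u. set_integrable lborel {0..T} u}"

definition Linf_space :: "real \<Rightarrow> (real \<Rightarrow> real) set" where
  "Linf_space T = {a. set_borel_measurable lborel {0..T} a \<and>
     (\<exists>C. AE t in lborel. t \<in> {0..T} \<longrightarrow> \<bar>a t\<bar> \<le> C)}"

definition primitive :: "(real \<Rightarrow> real) \<Rightarrow> real \<Rightarrow> real" where
  "primitive a t = (LBINT s:{0..t}. a s)"

definition geom_bm :: "(real \<Rightarrow> 'a \<Rightarrow> real) \<Rightarrow> real \<Rightarrow> 'a \<Rightarrow> real" where
  "geom_bm W t \<omega> = exp (W t \<omega> - t / 2)"

text \<open>The integral is taken path by path. On the (null, under the assumptions of interest) set of
  paths whose integrand is not integrable, the Bochner integral is \<open>0\<close> by convention.\<close>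

definition controlled_state ::
    "(real \<Rightarrow> real) \<Rightarrow> (real \<Rightarrow> 'a \<Rightarrow> real) \<Rightarrow> (real \<Rightarrow> 'a \<Rightarrow> real) \<Rightarrow> (real \<Rightarrow> real) \<Rightarrow>
     real \<Rightarrow> 'a \<Rightarrow> real" where
  "controlled_state a W z u t \<omega> =
     geom_bm W t \<omega> * exp (primitive a t) *
     (LBINT s:{0..t}. exp (- primitive a s) / geom_bm W s \<omega> * (z s \<omega> - u s))"

text \<open>The cost is valued in \<open>[0,\<infinity>]\<close>. It is meant for nonnegative \<open>F\<close> only: \<^const>\<open>ennreal\<close> sends
  negative reals to \<open>0\<close>.\<close>

definition cost ::
    "'a measure \<Rightarrow> real \<Rightarrow> (real \<Rightarrow> real) \<Rightarrow> (real \<Rightarrow> 'a \<Rightarrow> real) \<Rightarrow> (real \<Rightarrow> 'a \<Rightarrow> real) \<Rightarrow>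
     (real \<Rightarrow> real \<Rightarrow> real) \<Rightarrow> (real \<Rightarrow> real) \<Rightarrow> ennreal" where
  "cost M T a W z F u =
     (\<integral>\<^sup>+\<omega>. (\<integral>\<^sup>+t\<in>{0..T}. ennreal (F t (controlled_state a W z u t \<omega>)) \<partial>lborel) \<partial>M)"

text \<open>Functions on \<open>[0,\<infinity>)\<close> are total functions on the reals whose values at negative arguments are
  left unconstrained. Nonnegativity of \<open>\<psi>\<close> and \<open>\<Psi>\<close> on \<open>[0,\<infinity>)\<close> follows from the other clauses.\<close>

definition young_function :: "(real \<Rightarrow> real) \<Rightarrow> bool" where
  "young_function \<Psi> \<longleftrightarrow>
     (\<exists>\<psi>::real \<Rightarrow> real.
        \<psi> 0 = 0 \<and> (\<forall>s>0. \<psi> s > 0) \<and>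
        (\<forall>s\<ge>0. continuous (at_right s) \<psi>) \<and>
        mono_on {0..} \<psi> \<and>
        filterlim \<psi> at_top at_top \<and>
        (\<forall>t\<ge>0. \<Psi> t = (LBINT s:{0..t}. \<psi> s)))"

definition Delta2 :: "(real \<Rightarrow> real) \<Rightarrow> bool" where
  "Delta2 \<Psi> \<longleftrightarrow> (\<exists>k>0. \<forall>t\<ge>0. \<Psi> (2 * t) \<le> k * \<Psi> t)"

definition young_penalty :: "real \<Rightarrow> (real \<Rightarrow> real) \<Rightarrow> (real \<Rightarrow> real) \<Rightarrow> ennreal" where
  "young_penalty T \<Psi> u = (\<integral>\<^sup>+t\<in>{0..T}. ennreal (\<Psi> \<bar>u t\<bar>) \<partial>lborel)"

definition regularized_cost ::
    "'a measure \<Rightarrow> real \<Rightarrow> (real \<Rightarrow> real) \<Rightarrow> (real \<Rightarrow> 'a \<Rightarrow> real) \<Rightarrow> (real \<Rightarrow> 'a \<Rightarrow> real) \<Rightarrow>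
     (real \<Rightarrow> real \<Rightarrow> real) \<Rightarrow> real \<Rightarrow> (real \<Rightarrow> real) \<Rightarrow> (real \<Rightarrow> real) \<Rightarrow> ennreal" where
  "regularized_cost M T a W z F \<delta> \<Psi> u =
     cost M T a W z F u + ennreal \<delta> * young_penalty T \<Psi> u"

end

theory Submission
  imports Defs
begin

text \<open>Minimality gives \<open>J[ubar \<delta>] \<le> J[v] + \<delta> F\<^sub>\<Psi>[v]\<close> for every control \<open>v\<close>. If \<open>v\<close> has finite penalty and
  \<open>J[v]\<close> is within \<open>\<epsilon> / 2\<close> of the infimum \<open>m\<close>, then small \<open>\<delta>\<close> give \<open>J[ubar \<delta>] \<le> m + \<epsilon>\<close>. So it
  suffices that controls of finite penalty come arbitrarily close to \<open>m\<close>. Bounded controls have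
  finite penalty, as \<open>\<Psi>\<close> is bounded on bounded intervals; and if \<open>u\<close> is any integrable control, its
  truncations \<open>u 1\<^bsub>{\<bar>u\<bar> \<le> n}\<^esub>\<close> are bounded and, as will be seen, their costs converge to \<open>J[u]\<close>.

  The convergence is the analytic content (\<open>cost_dominated_convergence\<close>). The truncations converge
  pointwise and are dominated by \<open>\<bar>u\<bar>\<close>, so all that is needed is one integrable function of time and
  scenario above all the running costs. These grow at most like \<open>L t * (1 + \<bar>\<xi>\<bar> powr p)\<close>, hence the
  question is a bound, uniform in \<open>t\<close>, on the \<open>p\<close>-th moment of the state for the integrand
  \<open>\<bar>z\<bar> + \<bar>u\<bar>\<close>. The ratio \<open>G t / G s\<close> is independent of \<open>\<F> s\<close> and has Gaussian exponential moments
  (\<open>brownian_increment_exp_moment\<close>), so at time \<open>s\<close> the integrand of the state has \<open>L\<^sup>p(\<Omega>)\<close> norm at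
  most a constant times that of \<open>\<bar>z s\<bar> + \<bar>u s\<bar>\<close>, which is integrable in \<open>s\<close>. Integrating
  over \<open>s\<close> preserves the bound by a weighted power mean inequality (\<open>weighted_power_mean\<close>).\<close>

section \<open>Power inequalities\<close>

text \<open>Young's inequality for the conjugate exponents \<open>p\<close> and \<open>p / (p - 1)\<close>, applied to \<open>y\<close> and
  \<open>c powr (p - 1)\<close>. Unlike the tangent inequality for a convex function on \<open>{0<..}\<close>, this form
  includes the endpoint \<open>0\<close>, where the integrands below may well be.\<close>

lemma powr_above_tangent:
  fixes c p y :: real
  assumes "p > 1" "c \<ge> 0" "y \<ge> 0"
  shows "c powr p + p * c powr (p - 1) * (y - c) \<le> y powr p"
proof -
  define q where "q = p / (p - 1)"
  have q: "q > 1" "1 / p + 1 / q = 1"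
    using assms(1) by (auto simp: q_def field_simps)
  have "y * c powr (p - 1) \<le> y powr p / p + (c powr (p - 1)) powr q / q"
    using q assms by (intro Youngs_inequality) auto
  also have "(c powr (p - 1)) powr q = c powr p"
    using assms(1) by (simp add: powr_powr q_def)
  finally have "p * (y * c powr (p - 1)) \<le> y powr p + (p - 1) * c powr p"
    using assms(1) by (simp add: q_def field_simps)
  moreover have "c powr p = c * c powr (p - 1)"
    using assms(2) by (simp add: powr_mult_base)
  ultimately show ?thesis
    by (simp add: algebra_simps)
qed

lemma powr_add_le:
  fixes x y p :: real
  assumes "x \<ge> 0" "y \<ge> 0" "p \<ge> 0"
  shows "(x + y) powr p \<le> 2 powr p * (x powr p + y powr p)"
proof -
  have "(x + y) powr p \<le> (2 * max x y) powr p"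
    using assms by (intro powr_mono2) auto
  also have "\<dots> = 2 powr p * max x y powr p"
    using assms by (simp add: powr_mult)
  also have "max x y powr p \<le> x powr p + y powr p"
    by (auto simp: max_def)
  finally show ?thesis by simp
qed

text \<open>Hoelder's inequality for \<open>f = (f / h) h\<close>, that is, Jensen's inequality for \<open>f / h\<close> under the
  measure with density \<open>h\<close>. It takes the place of Minkowski's integral inequality: with \<open>h s\<close>
  comparable to the \<open>L\<^sup>p(\<Omega>)\<close> norm of the integrand at \<open>s\<close>, the expectation of the right-hand side
  is finite, while the right-hand side itself is a single jointly measurable function of time and
  scenario, which can serve as a dominating function.\<close>

lemma weighted_power_mean:
  fixes f h :: "'b \<Rightarrow> real"
  assumes p: "p > 1"
    and f[measurable]: "f \<in> borel_measurable N" and f_nonneg: "\<And>x. x \<in> space N \<Longrightarrow> f x \<ge> 0"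
    and h: "integrable N h" and h_pos: "\<And>x. x \<in> space N \<Longrightarrow> h x > 0"
    and fh: "integrable N (\<lambda>x. f x powr p * h x powr (1 - p))"
  shows "integrable N f"
    and "(LINT x|N. f x) powr p
      \<le> (LINT x|N. h x) powr (p - 1) * (LINT x|N. f x powr p * h x powr (1 - p))"
proof -
  \<comment> \<open>If \<open>f > h\<close>, then \<open>f = f powr p * f powr (1 - p)\<close>, and the power \<open>1 - p\<close> is decreasing.\<close>
  have le: "f x \<le> h x + f x powr p * h x powr (1 - p)" if x: "x \<in> space N" for x
  proof (cases "f x \<le> h x")
    case False
    then have "f x powr (1 - p) \<le> h x powr (1 - p)"
      using p h_pos[OF x] by (intro powr_mono2') auto
    then have "f x powr p * f x powr (1 - p) \<le> f x powr p * h x powr (1 - p)"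
      by (intro mult_left_mono) auto
    then show ?thesis
      using False h_pos[OF x] by (simp flip: powr_add)
  qed (auto intro: add_increasing2)
  show int_f: "integrable N f"
    by (rule Bochner_Integration.integrable_bound[OF Bochner_Integration.integrable_add[OF h fh]])
       (use le f_nonneg in \<open>auto intro!: AE_I2 order_trans[OF le]\<close>)
  define H where "H = (LINT x|N. h x)"
  define I where "I = (LINT x|N. f x)"
  have I: "I \<ge> 0"
    unfolding I_def using f_nonneg by (intro integral_nonneg_AE AE_I2) auto
  have H0: "H \<ge> 0"
    unfolding H_def using h_pos by (intro integral_nonneg_AE AE_I2) (auto intro: less_imp_le)
  have R0: "(LINT x|N. f x powr p * h x powr (1 - p)) \<ge> 0"
    by (intro integral_nonneg_AE AE_I2) auto
  show "I powr p \<le> H powr (p - 1) * (LINT x|N. f x powr p * h x powr (1 - p))"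
  proof (cases "H = 0")
    case True
    then have "AE x in N. h x = 0"
      using integral_nonneg_eq_0_iff_AE[OF h] AE_I2[of N "\<lambda>x. 0 \<le> h x"] h_pos
      by (auto simp: H_def less_imp_le)
    then have "AE x in N. f x = 0"
      using AE_space by eventually_elim (use h_pos in force)
    then have "I = 0"
      unfolding I_def by (subst integral_cong_AE[where g = "\<lambda>_. 0"]) auto
    then show ?thesis
      using R0 by (simp add: True)
  next
    case False
    with H0 have H: "H > 0" by simp
    \<comment> \<open>The mean of \<open>f / h\<close> under the density \<open>h / H\<close>; the tangent there has vanishing linear
      part after integration.\<close>
    define c where "c = I / H"
    have c: "c \<ge> 0" using I H by (simp add: c_def)
    have tangent: "c powr p * h x + p * c powr (p - 1) * (f x - c * h x)
        \<le> f x powr p * h x powr (1 - p)" if x: "x \<in> space N" for x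
    proof -
      have "h x * (c powr p + p * c powr (p - 1) * (f x / h x - c)) \<le> h x * (f x / h x) powr p"
        using h_pos[OF x] f_nonneg[OF x] p c
        by (intro mult_left_mono powr_above_tangent) auto
      also have "h x * (f x / h x) powr p = f x powr p * (h x powr 1 / h x powr p)"
        using h_pos[OF x] f_nonneg[OF x] by (simp add: powr_divide)
      also have "\<dots> = f x powr p * h x powr (1 - p)"
        by (simp add: powr_diff)
      finally have "h x * (c powr p + p * c powr (p - 1) * (f x / h x - c))
          \<le> f x powr p * h x powr (1 - p)" .
      moreover have "h x * (c powr p + p * c powr (p - 1) * (f x / h x - c))
          = c powr p * h x + p * c powr (p - 1) * (f x - c * h x)"
        using h_pos[OF x] by (simp add: field_simps)
      ultimately show ?thesis by simp
    qed
    have "(LINT x|N. c powr p * h x + p * c powr (p - 1) * (f x - c * h x))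
        \<le> (LINT x|N. f x powr p * h x powr (1 - p))"
      using tangent
      by (intro integral_mono fh Bochner_Integration.integrable_add integrable_mult_right
          Bochner_Integration.integrable_diff int_f h)
    also have "(LINT x|N. c powr p * h x + p * c powr (p - 1) * (f x - c * h x))
        = c powr p * H + p * c powr (p - 1) * (I - c * H)"
      using int_f h by (simp add: H_def I_def)
    also have "\<dots> = c powr p * H"
      using H by (simp add: c_def)
    finally have "H powr (p - 1) * (c powr p * H)
        \<le> H powr (p - 1) * (LINT x|N. f x powr p * h x powr (1 - p))"
      by (intro mult_left_mono) auto
    also have "H powr (p - 1) * (c powr p * H) = (c * H) powr p"
      using H c by (simp add: powr_mult powr_diff)
    also have "c * H = I"
      using H by (simp add: c_def)
    finally show ?thesis .
  qed
qed

section \<open>Exponential moments of Brownian increments\<close>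

text \<open>Completing the square turns the exponentially tilted centred density into a multiple of the normal
  density with mean \<open>c * \<sigma>\<^sup>2\<close>.\<close>

lemma nn_integral_exp_normal_density:
  assumes "\<sigma> > 0"
  shows "(\<integral>\<^sup>+x. ennreal (normal_density 0 \<sigma> x) * ennreal (exp (c * x)) \<partial>lborel)
    = ennreal (exp (c\<^sup>2 * \<sigma>\<^sup>2 / 2))"
proof -
  have eq: "normal_density 0 \<sigma> x * exp (c * x)
      = exp (c\<^sup>2 * \<sigma>\<^sup>2 / 2) * normal_density (c * \<sigma>\<^sup>2) \<sigma> x" for x
  proof -
    have "- x\<^sup>2 / (2 * \<sigma>\<^sup>2) + c * x = c\<^sup>2 * \<sigma>\<^sup>2 / 2 + - (x - c * \<sigma>\<^sup>2)\<^sup>2 / (2 * \<sigma>\<^sup>2)"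
      using assms by (simp add: field_simps power2_eq_square)
    then have "exp (- x\<^sup>2 / (2 * \<sigma>\<^sup>2)) * exp (c * x)
        = exp (c\<^sup>2 * \<sigma>\<^sup>2 / 2) * exp (- (x - c * \<sigma>\<^sup>2)\<^sup>2 / (2 * \<sigma>\<^sup>2))"
      by (simp flip: exp_add)
    then show ?thesis
      by (simp add: normal_density_def)
  qed
  interpret P: prob_space "density lborel (normal_density (c * \<sigma>\<^sup>2) \<sigma>)"
    using assms by (rule prob_space_normal_density)
  have "(\<integral>\<^sup>+x. ennreal (normal_density 0 \<sigma> x) * ennreal (exp (c * x)) \<partial>lborel)
      = (\<integral>\<^sup>+x. ennreal (exp (c\<^sup>2 * \<sigma>\<^sup>2 / 2)) * ennreal (normal_density (c * \<sigma>\<^sup>2) \<sigma> x) \<partial>lborel)"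
    by (intro nn_integral_cong) (simp add: eq flip: ennreal_mult)
  also have "\<dots> = ennreal (exp (c\<^sup>2 * \<sigma>\<^sup>2 / 2)) * (\<integral>\<^sup>+x. ennreal (normal_density (c * \<sigma>\<^sup>2) \<sigma> x) \<partial>lborel)"
    by (rule nn_integral_cmult) auto
  also have "(\<integral>\<^sup>+x. ennreal (normal_density (c * \<sigma>\<^sup>2) \<sigma> x) \<partial>lborel) = 1"
    using P.emeasure_space_1 by (simp add: emeasure_density)
  finally show ?thesis by simp
qed

lemma (in prob_space) nn_integral_mult_indep_set:
  fixes X Y :: "'a \<Rightarrow> ennreal"
  assumes A: "subalgebra M A" and B: "subalgebra M B" and indep: "indep_set (sets A) (sets B)"
    and X: "X \<in> borel_measurable A" and Y: "Y \<in> borel_measurable B"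
  shows "(\<integral>\<^sup>+\<omega>. X \<omega> * Y \<omega> \<partial>M) = (\<integral>\<^sup>+\<omega>. X \<omega> \<partial>M) * (\<integral>\<^sup>+\<omega>. Y \<omega> \<partial>M)"
proof -
  have XM[measurable]: "X \<in> borel_measurable M" and YM[measurable]: "Y \<in> borel_measurable M"
    using measurable_from_subalg A B X Y by blast+
  have gen: "sigma_sets (space M) {Z -` S \<inter> space M |S. S \<in> sets borel} \<subseteq> sets C"
    if "subalgebra M C" "Z \<in> borel_measurable C" for C and Z :: "'a \<Rightarrow> ennreal"
  proof -
    have sp: "space C = space M"
      using that(1) by (simp add: subalgebra_def)
    have "sigma_sets (space C) {Z -` S \<inter> space C |S. S \<in> sets borel} \<subseteq> sets C"
      using measurable_sets[OF that(2)] by (intro sets.sigma_sets_subset) auto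
    then show ?thesis
      by (simp add: sp)
  qed
  have "indep_var borel X borel Y"
    unfolding indep_var_eq
    using indep gen[OF A X] gen[OF B Y] unfolding indep_sets2_eq by (auto 0 3)
  then have eq: "distr M borel X \<Otimes>\<^sub>M distr M borel Y = distr M (borel \<Otimes>\<^sub>M borel) (\<lambda>\<omega>. (X \<omega>, Y \<omega>))"
    by (simp add: indep_var_distribution_eq)
  interpret PY: prob_space "distr M borel Y"
    by (rule prob_space_distr) simp
  have "(\<integral>\<^sup>+\<omega>. X \<omega> * Y \<omega> \<partial>M)
      = (\<integral>\<^sup>+z. fst z * snd z \<partial>distr M (borel \<Otimes>\<^sub>M borel) (\<lambda>\<omega>. (X \<omega>, Y \<omega>)))"
    by (subst nn_integral_distr) auto
  also have "\<dots> = (\<integral>\<^sup>+x. \<integral>\<^sup>+y. x * y \<partial>distr M borel Y \<partial>distr M borel X)"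
    unfolding eq[symmetric] by (subst PY.nn_integral_fst[symmetric]) auto
  also have "\<dots> = (\<integral>\<^sup>+\<omega>. X \<omega> \<partial>M) * (\<integral>\<^sup>+\<omega>. Y \<omega> \<partial>M)"
    by (simp add: nn_integral_cmult nn_integral_multc nn_integral_distr)
  finally show ?thesis .
qed

text \<open>The increment is independent of the past, so no integrability is traded between the kernel
  \<open>G t / G s\<close> and an \<open>\<F> s\<close>-measurable factor: a factor in \<open>L\<^sup>p\<close> stays in \<open>L\<^sup>p\<close> with the same exponent.\<close>

lemma brownian_increment_exp_moment:
  assumes M: "filtered_prob_space M \<F>" and W: "brownian_motion M \<F> W"
    and st: "0 \<le> s" "s \<le> t" and X: "X \<in> borel_measurable (\<F> s)"
  shows "(\<integral>\<^sup>+\<omega>. X \<omega> * ennreal (exp (c * (W t \<omega> - W s \<omega>))) \<partial>M)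
    = ennreal (exp (c\<^sup>2 * (t - s) / 2)) * (\<integral>\<^sup>+\<omega>. X \<omega> \<partial>M)"
proof (cases "s = t")
  case False
  define D where "D \<omega> = W t \<omega> - W s \<omega>" for \<omega>
  interpret prob_space M
    using M by (simp add: filtered_prob_space_def)
  have sub: "subalgebra M (\<F> s)"
    using M st by (simp add: filtered_prob_space_def)
  have dist: "distributed M lborel D (normal_density 0 (sqrt (t - s)))"
    and indep: "indep_set (sets (\<F> s)) (sets (vimage_algebra (space M) D borel))"
    using W st False by (auto simp: brownian_motion_def D_def[abs_def])
  have D[measurable]: "D \<in> borel_measurable M"
    using distributed_measurable[OF dist] by simp
  have D': "D \<in> borel_measurable (vimage_algebra (space M) D borel)"
    by (rule measurable_vimage_algebra1) auto
  have subD: "subalgebra M (vimage_algebra (space M) D borel)"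
    using measurable_sets[OF D] by (auto simp: subalgebra_def sets_vimage_algebra2)
  have "(\<integral>\<^sup>+\<omega>. X \<omega> * ennreal (exp (c * D \<omega>)) \<partial>M)
      = (\<integral>\<^sup>+\<omega>. X \<omega> \<partial>M) * (\<integral>\<^sup>+\<omega>. ennreal (exp (c * D \<omega>)) \<partial>M)"
    by (intro nn_integral_mult_indep_set[OF sub subD indep X] measurable_compose[OF D']) measurable
  also have "(\<integral>\<^sup>+\<omega>. ennreal (exp (c * D \<omega>)) \<partial>M)
      = (\<integral>\<^sup>+x. ennreal (normal_density 0 (sqrt (t - s)) x) * ennreal (exp (c * x)) \<partial>lborel)"
    by (rule distributed_nn_integral[OF dist, symmetric]) simp
  also have "\<dots> = ennreal (exp (c\<^sup>2 * (t - s) / 2))"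
    using st False by (simp add: nn_integral_exp_normal_density)
  finally show ?thesis
    by (simp add: D_def mult.commute)
qed simp

section \<open>A jointly measurable modification of Brownian motion\<close>

text \<open>A continuous path is the limit of its values at the times \<open>\<lfloor>n t\<rfloor> / n\<close>, and each of these
  discretizations involves countably many times only.\<close>

lemma borel_measurable_pair_continuous:
  fixes Y :: "real \<Rightarrow> 'a \<Rightarrow> real"
  assumes meas: "\<And>t. Y t \<in> borel_measurable M"
    and cont: "\<And>\<omega>. \<omega> \<in> space M \<Longrightarrow> continuous_on UNIV (\<lambda>t. Y t \<omega>)"
  shows "(\<lambda>(t, \<omega>). Y t \<omega>) \<in> borel_measurable (borel \<Otimes>\<^sub>M M)"
proof -
  define r where "r n t = real_of_int \<lfloor>real (Suc n) * t\<rfloor> / real (Suc n)" for n t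
  have r: "(\<lambda>n. r n t) \<longlonglongrightarrow> t" for t
  proof (rule tendsto_sandwich)
    show "eventually (\<lambda>n. t - inverse (real (Suc n)) \<le> r n t) sequentially"
    proof (intro always_eventually allI)
      fix n
      have "real (Suc n) * t - 1 \<le> real_of_int \<lfloor>real (Suc n) * t\<rfloor>" by linarith
      then have "(real (Suc n) * t - 1) / real (Suc n) \<le> r n t"
        unfolding r_def by (intro divide_right_mono) auto
      then show "t - inverse (real (Suc n)) \<le> r n t"
        by (simp add: diff_divide_distrib inverse_eq_divide del: of_nat_Suc)
    qed
    show "eventually (\<lambda>n. r n t \<le> t) sequentially"
    proof (intro always_eventually allI)
      fix n
      have "real_of_int \<lfloor>real (Suc n) * t\<rfloor> / real (Suc n) \<le> (real (Suc n) * t) / real (Suc n)"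
        by (intro divide_right_mono) auto
      then show "r n t \<le> t"
        by (simp add: r_def del: of_nat_Suc)
    qed
    show "(\<lambda>n. t - inverse (real (Suc n))) \<longlonglongrightarrow> t"
      using tendsto_diff[OF tendsto_const LIMSEQ_inverse_real_of_nat, of t] by simp
  qed simp
  have step: "(\<lambda>x. Y (r n (fst x)) (snd x)) \<in> borel_measurable (borel \<Otimes>\<^sub>M M)" for n
  proof -
    have floor: "(\<lambda>x. \<lfloor>real (Suc n) * fst x\<rfloor>) \<in> borel \<Otimes>\<^sub>M M \<rightarrow>\<^sub>M count_space UNIV"
      by measurable
    have "(\<lambda>x. (\<lambda>i::int. \<lambda>x. Y (real_of_int i / real (Suc n)) (snd x)) \<lfloor>real (Suc n) * fst x\<rfloor> x)
        \<in> borel_measurable (borel \<Otimes>\<^sub>M M)"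
      by (rule measurable_compose_countable)
         (auto intro!: measurable_compose[OF measurable_snd meas] floor)
    then show ?thesis
      by (simp add: r_def)
  qed
  have "(\<lambda>x. Y (fst x) (snd x)) \<in> borel_measurable (borel \<Otimes>\<^sub>M M)"
  proof (rule borel_measurable_LIMSEQ_metric[OF step])
    fix x :: "real \<times> 'a" assume "x \<in> space (borel \<Otimes>\<^sub>M M)"
    then have "isCont (\<lambda>t. Y t (snd x)) (fst x)"
      using cont by (auto simp: space_pair_measure continuous_on_eq_continuous_at)
    from isCont_tendsto_compose[OF this r]
    show "(\<lambda>n. Y (r n (fst x)) (snd x)) \<longlonglongrightarrow> Y (fst x) (snd x)" .
  qed
  then show ?thesis
    by (simp add: case_prod_beta')
qed

text \<open>Paths of \<open>W\<close> are continuous only almost surely, so \<open>W\<close> need not be jointly measurable, and without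
  joint measurability Fubini's theorem does not apply to the cost. Killing the paths in a measurable
  null set that contains the discontinuous ones repairs this without changing the cost. The
  modification is in general not adapted; independence is always used for \<open>W\<close> itself.\<close>

lemma brownian_motion_modification:
  assumes "filtered_prob_space M \<F>" and W: "brownian_motion M \<F> W"
  obtains B where "(\<lambda>(t, \<omega>). B t \<omega>) \<in> borel_measurable (borel \<Otimes>\<^sub>M M)"
    and "AE \<omega> in M. \<forall>t\<ge>0. B t \<omega> = W t \<omega>"
proof -
  have sub: "subalgebra M (\<F> t)" if "t \<ge> 0" for t
    using assms(1) that by (simp add: filtered_prob_space_def)
  have W_meas: "W t \<in> borel_measurable M" if "t \<ge> 0" for t
    using W that by (intro measurable_from_subalg[OF sub[OF that]]) (auto simp: brownian_motion_def)
  have "AE \<omega> in M. continuous_on {0..} (\<lambda>t. W t \<omega>)"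
    using W by (simp add: brownian_motion_def)
  then obtain N where N: "{\<omega> \<in> space M. \<not> continuous_on {0..} (\<lambda>t. W t \<omega>)} \<subseteq> N"
      "emeasure M N = 0" "N \<in> sets M"
    by (rule AE_E)
  define B where "B t \<omega> = (if \<omega> \<in> N then 0 else W (max 0 t) \<omega>)" for t \<omega>
  show thesis
  proof
    show "(\<lambda>(t, \<omega>). B t \<omega>) \<in> borel_measurable (borel \<Otimes>\<^sub>M M)"
    proof (rule borel_measurable_pair_continuous)
      show "B t \<in> borel_measurable M" for t
        unfolding B_def using N(3) W_meas[of "max 0 t"] by measurable
      show "continuous_on UNIV (\<lambda>t. B t \<omega>)" if "\<omega> \<in> space M" for \<omega>
      proof (cases "\<omega> \<in> N")
        case False
        then have "continuous_on {0..} (\<lambda>t. W t \<omega>)" using N(1) that by auto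
        then have "continuous_on UNIV (\<lambda>t. W (max 0 t) \<omega>)"
          by (rule continuous_on_compose2) (auto intro!: continuous_intros)
        with False show ?thesis by (simp add: B_def)
      qed (simp add: B_def)
    qed
    have "AE \<omega> in M. \<omega> \<notin> N"
      using N by (intro AE_not_in) (auto simp: null_sets_def)
    then show "AE \<omega> in M. \<forall>t\<ge>0. B t \<omega> = W t \<omega>"
      by eventually_elim (auto simp: B_def max_def)
  qed
qed

section \<open>Dominated convergence for iterated costs\<close>

text \<open>The state is an integral over \<open>s\<close> inside a nonlinear running cost that is integrated over time and
  scenario; convergence of the integrands \<open>x n\<close> has to pass through both levels. A pair \<open>y\<close> stands
  for time and scenario, \<open>f\<close> dominates the inner integrands, and \<open>h s\<close> bounds the \<open>L\<^sup>p(\<Omega>)\<close> norm of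
  \<open>f (t, \<cdot>) s\<close> up to a factor, uniformly in \<open>t\<close>. The weighted power mean inequality bounds the
  \<open>p\<close>-th power of the inner integral of \<open>f\<close> by a multiple of a function \<open>D\<close> whose expectation is
  bounded uniformly in time. Where \<open>D\<close> is finite, \<open>f y\<close> is integrable, which gives convergence of
  the inner integrals; and \<open>L t * (1 + const * D y)\<close> dominates the running costs.\<close>

theorem nested_integral_dominated_convergence:
  fixes R :: "'t measure" and M :: "'a measure"
    and f :: "'t \<times> 'a \<Rightarrow> 't \<Rightarrow> real" and h L :: "'t \<Rightarrow> real"
    and \<Phi> :: "'t \<Rightarrow> real \<Rightarrow> real"
    and x :: "nat \<Rightarrow> 't \<times> 'a \<Rightarrow> 't \<Rightarrow> real" and x' :: "'t \<times> 'a \<Rightarrow> 't \<Rightarrow> real"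
  assumes R: "finite_measure R" and M: "prob_space M" and p: "p > 1" and C: "C \<ge> 0"
    and f_meas[measurable]: "(\<lambda>(y, s). f y s) \<in> borel_measurable ((R \<Otimes>\<^sub>M M) \<Otimes>\<^sub>M R)"
    and f_nonneg: "\<And>y s. y \<in> space (R \<Otimes>\<^sub>M M) \<Longrightarrow> s \<in> space R \<Longrightarrow> f y s \<ge> 0"
    and h: "integrable R h" and h_pos: "\<And>s. s \<in> space R \<Longrightarrow> h s > 0"
    and moment: "\<And>t s. t \<in> space R \<Longrightarrow> s \<in> space R \<Longrightarrow>
      (\<integral>\<^sup>+\<omega>. ennreal (f (t, \<omega>) s powr p) \<partial>M) \<le> ennreal (C * h s powr p)"
    and L: "integrable R L" and L_nonneg: "\<And>t. t \<in> space R \<Longrightarrow> L t \<ge> 0"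
    and \<Phi>_meas: "(\<lambda>(t, \<xi>). \<Phi> t \<xi>) \<in> borel_measurable (R \<Otimes>\<^sub>M borel)"
    and \<Phi>_cont: "\<And>t \<xi>. t \<in> space R \<Longrightarrow> isCont (\<Phi> t) \<xi>"
    and \<Phi>_growth: "\<And>t \<xi>. t \<in> space R \<Longrightarrow> \<Phi> t \<xi> \<le> L t * (1 + \<bar>\<xi>\<bar> powr p)"
    and x_meas: "\<And>n. (\<lambda>(y, s). x n y s) \<in> borel_measurable ((R \<Otimes>\<^sub>M M) \<Otimes>\<^sub>M R)"
    and x'_meas: "(\<lambda>(y, s). x' y s) \<in> borel_measurable ((R \<Otimes>\<^sub>M M) \<Otimes>\<^sub>M R)"
    and x_le: "\<And>n y s. y \<in> space (R \<Otimes>\<^sub>M M) \<Longrightarrow> s \<in> space R \<Longrightarrow> \<bar>x n y s\<bar> \<le> f y s"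
    and x_lim: "\<And>y s. y \<in> space (R \<Otimes>\<^sub>M M) \<Longrightarrow> s \<in> space R \<Longrightarrow> (\<lambda>n. x n y s) \<longlonglongrightarrow> x' y s"
  shows "(\<lambda>n. \<integral>\<^sup>+\<omega>. \<integral>\<^sup>+t. ennreal (\<Phi> t (LINT s|R. x n (t, \<omega>) s)) \<partial>R \<partial>M)
      \<longlonglongrightarrow> (\<integral>\<^sup>+\<omega>. \<integral>\<^sup>+t. ennreal (\<Phi> t (LINT s|R. x' (t, \<omega>) s)) \<partial>R \<partial>M)"
    and "(\<integral>\<^sup>+\<omega>. \<integral>\<^sup>+t. ennreal (\<Phi> t (LINT s|R. x' (t, \<omega>) s)) \<partial>R \<partial>M) < \<infinity>"
proof -
  interpret R: finite_measure R by fact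
  interpret M: prob_space M by fact
  interpret RM: pair_sigma_finite R M ..
  have [measurable]: "h \<in> borel_measurable R" "L \<in> borel_measurable R"
    using h L by auto
  note [measurable] = x_meas x'_meas
  have \<Phi>_pair[measurable]: "(\<lambda>z. \<Phi> (fst z) (snd z)) \<in> borel_measurable (R \<Otimes>\<^sub>M borel)"
    using \<Phi>_meas by (simp add: case_prod_beta')
  define H where "H = (LINT s|R. h s)"
  have H: "H \<ge> 0"
    unfolding H_def using h_pos by (intro integral_nonneg_AE AE_I2) (auto intro: less_imp_le)
  define D where "D y = (\<integral>\<^sup>+s. ennreal (f y s powr p * h s powr (1 - p)) \<partial>R)" for y
  have D_meas[measurable]: "D \<in> borel_measurable (R \<Otimes>\<^sub>M M)"
    unfolding D_def by measurable
  have D_moment: "(\<integral>\<^sup>+\<omega>. D (t, \<omega>) \<partial>M) \<le> ennreal (C * H)" if t: "t \<in> space R" for t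
  proof -
    have [measurable]: "(\<lambda>z. f (t, snd z) (fst z)) \<in> borel_measurable (R \<Otimes>\<^sub>M M)"
      using t by measurable
    have "(\<integral>\<^sup>+\<omega>. D (t, \<omega>) \<partial>M)
        = (\<integral>\<^sup>+s. \<integral>\<^sup>+\<omega>. ennreal (f (t, \<omega>) s powr p * h s powr (1 - p)) \<partial>M \<partial>R)"
      unfolding D_def by (rule RM.Fubini') measurable
    also have "\<dots> \<le> (\<integral>\<^sup>+s. ennreal (C * h s) \<partial>R)"
    proof (rule nn_integral_mono)
      fix s assume s: "s \<in> space R"
      have [measurable]: "(\<lambda>\<omega>. f (t, \<omega>) s) \<in> borel_measurable M"
        using t s by measurable
      have "(\<integral>\<^sup>+\<omega>. ennreal (f (t, \<omega>) s powr p * h s powr (1 - p)) \<partial>M)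
          = (\<integral>\<^sup>+\<omega>. ennreal (f (t, \<omega>) s powr p) \<partial>M) * ennreal (h s powr (1 - p))"
        by (subst nn_integral_multc[symmetric]) (auto simp: ennreal_mult)
      also have "\<dots> \<le> ennreal (C * h s powr p) * ennreal (h s powr (1 - p))"
        by (intro mult_right_mono moment t s) simp
      also have "\<dots> = ennreal (C * h s)"
        using C h_pos[OF s] by (simp add: mult.assoc flip: ennreal_mult powr_add)
      finally show "(\<integral>\<^sup>+\<omega>. ennreal (f (t, \<omega>) s powr p * h s powr (1 - p)) \<partial>M) \<le> ennreal (C * h s)" .
    qed
    also have "\<dots> = ennreal (C * H)"
      using h h_pos C
      by (subst nn_integral_eq_integral) (auto intro!: AE_I2 simp: H_def less_imp_le)
    finally show ?thesis .
  qed
  have D_int: "(\<integral>\<^sup>+y. D y \<partial>(R \<Otimes>\<^sub>M M)) < \<infinity>"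
  proof -
    have "(\<integral>\<^sup>+y. D y \<partial>(R \<Otimes>\<^sub>M M)) = (\<integral>\<^sup>+t. \<integral>\<^sup>+\<omega>. D (t, \<omega>) \<partial>M \<partial>R)"
      by (rule M.nn_integral_fst[symmetric]) measurable
    also have "\<dots> \<le> (\<integral>\<^sup>+t. ennreal (C * H) \<partial>R)"
      by (intro nn_integral_mono D_moment)
    also have "\<dots> < \<infinity>"
      by (simp add: ennreal_mult_eq_top_iff flip: less_top)
    finally show ?thesis .
  qed
  have D_fin: "AE y in R \<Otimes>\<^sub>M M. D y < \<infinity>"
    using nn_integral_PInf_AE[OF D_meas] D_int by (auto simp: less_top)
  have f_int: "integrable R (f y)"
    and f_power: "ennreal ((LINT s|R. f y s) powr p) \<le> ennreal (H powr (p - 1)) * D y"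
    if y: "y \<in> space (R \<Otimes>\<^sub>M M)" and "D y < \<infinity>" for y
  proof -
    have [measurable]: "f y \<in> borel_measurable R"
      using y by measurable
    have int: "integrable R (\<lambda>s. f y s powr p * h s powr (1 - p))"
      using \<open>D y < \<infinity>\<close> unfolding D_def by (intro integrableI_nonneg) auto
    show "integrable R (f y)"
      by (rule weighted_power_mean(1)[OF p _ _ h h_pos int]) (use f_nonneg y in auto)
    have "(LINT s|R. f y s) powr p
        \<le> H powr (p - 1) * (LINT s|R. f y s powr p * h s powr (1 - p))"
      unfolding H_def
      by (rule weighted_power_mean(2)[OF p _ _ h h_pos int]) (use f_nonneg y in auto)
    also have "ennreal \<dots> = ennreal (H powr (p - 1)) * D y"
      unfolding D_def by (subst nn_integral_eq_integral[OF int]) (auto simp: ennreal_mult')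
    finally show "ennreal ((LINT s|R. f y s) powr p) \<le> ennreal (H powr (p - 1)) * D y"
      by (simp add: ennreal_leI)
  qed
  define w where "w y = ennreal (L (fst y)) * (1 + ennreal (H powr (p - 1)) * D y)" for y
  have w_meas[measurable]: "w \<in> borel_measurable (R \<Otimes>\<^sub>M M)"
    unfolding w_def by measurable
  have w_int: "(\<integral>\<^sup>+y. w y \<partial>(R \<Otimes>\<^sub>M M)) < \<infinity>"
  proof -
    define c where "c = 1 + H powr (p - 1) * (C * H)"
    have c: "c \<ge> 0" using C H by (simp add: c_def)
    have "(\<integral>\<^sup>+y. w y \<partial>(R \<Otimes>\<^sub>M M)) = (\<integral>\<^sup>+t. \<integral>\<^sup>+\<omega>. w (t, \<omega>) \<partial>M \<partial>R)"
      by (rule M.nn_integral_fst[symmetric]) measurable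
    also have "\<dots> \<le> (\<integral>\<^sup>+t. ennreal (L t * c) \<partial>R)"
    proof (rule nn_integral_mono)
      fix t assume t: "t \<in> space R"
      have [measurable]: "(\<lambda>\<omega>. D (t, \<omega>)) \<in> borel_measurable M"
        using t by measurable
      have "(\<integral>\<^sup>+\<omega>. w (t, \<omega>) \<partial>M)
          = ennreal (L t) * (1 + ennreal (H powr (p - 1)) * (\<integral>\<^sup>+\<omega>. D (t, \<omega>) \<partial>M))"
        by (simp add: w_def nn_integral_cmult nn_integral_add M.emeasure_space_1)
      also have "\<dots> \<le> ennreal (L t) * (1 + ennreal (H powr (p - 1)) * ennreal (C * H))"
        by (intro mult_left_mono add_left_mono D_moment t) auto
      also have "\<dots> = ennreal (L t * c)"
        using C H L_nonneg[OF t] c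
        by (simp add: c_def flip: ennreal_mult ennreal_plus ennreal_1)
      finally show "(\<integral>\<^sup>+\<omega>. w (t, \<omega>) \<partial>M) \<le> ennreal (L t * c)" .
    qed
    also have "\<dots> = ennreal (LINT t|R. L t * c)"
      using L L_nonneg c by (intro nn_integral_eq_integral) auto
    also have "\<dots> < \<infinity>" by simp
    finally show ?thesis .
  qed
  have bound: "ennreal (\<Phi> (fst y) (LINT s|R. g s)) \<le> w y"
    if y: "y \<in> space (R \<Otimes>\<^sub>M M)" and D: "D y < \<infinity>" and g: "\<And>s. s \<in> space R \<Longrightarrow> \<bar>g s\<bar> \<le> f y s" for y g
  proof -
    have t: "fst y \<in> space R" using y by (auto simp: space_pair_measure)
    have "\<bar>LINT s|R. g s\<bar> \<le> (LINT s|R. f y s)"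
      by (intro order_trans[OF integral_abs_bound] integral_mono' f_int[OF y D] g f_nonneg[OF y])
    then have "\<bar>LINT s|R. g s\<bar> powr p \<le> (LINT s|R. f y s) powr p"
      using p by (intro powr_mono2) auto
    then have *: "ennreal (\<bar>LINT s|R. g s\<bar> powr p) \<le> ennreal (H powr (p - 1)) * D y"
      using f_power[OF y D] by (meson ennreal_leI order_trans)
    have "ennreal (\<Phi> (fst y) (LINT s|R. g s)) \<le> ennreal (L (fst y) * (1 + \<bar>LINT s|R. g s\<bar> powr p))"
      by (intro ennreal_leI \<Phi>_growth t)
    also have "\<dots> = ennreal (L (fst y)) * (1 + ennreal (\<bar>LINT s|R. g s\<bar> powr p))"
      using L_nonneg[OF t] by (simp add: ennreal_mult)
    also have "\<dots> \<le> w y"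
      unfolding w_def by (intro mult_left_mono add_left_mono *) auto
    finally show ?thesis .
  qed
  have x'_le: "\<bar>x' y s\<bar> \<le> f y s" if "y \<in> space (R \<Otimes>\<^sub>M M)" "s \<in> space R" for y s
    using LIMSEQ_le_const2[OF tendsto_rabs[OF x_lim[OF that]], of "f y s"] x_le[OF that] by auto
  have integrand_meas: "(\<lambda>y. ennreal (\<Phi> (fst y) (LINT s|R. g y s))) \<in> borel_measurable (R \<Otimes>\<^sub>M M)"
    if [measurable]: "(\<lambda>(y, s). g y s) \<in> borel_measurable ((R \<Otimes>\<^sub>M M) \<Otimes>\<^sub>M R)" for g
  proof -
    have g_int: "(\<lambda>y. LINT s|R. g y s) \<in> borel_measurable (R \<Otimes>\<^sub>M M)"
      by measurable
    show ?thesis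
      using measurable_compose[OF measurable_Pair[OF measurable_fst g_int] \<Phi>_pair] by simp
  qed
  have iter: "(\<integral>\<^sup>+\<omega>. \<integral>\<^sup>+t. ennreal (\<Phi> t (LINT s|R. g (t, \<omega>) s)) \<partial>R \<partial>M)
      = (\<integral>\<^sup>+y. ennreal (\<Phi> (fst y) (LINT s|R. g y s)) \<partial>(R \<Otimes>\<^sub>M M))"
    if "(\<lambda>(y, s). g y s) \<in> borel_measurable ((R \<Otimes>\<^sub>M M) \<Otimes>\<^sub>M R)" for g
    using RM.nn_integral_snd[OF integrand_meas[OF that]] by simp
  have "(\<lambda>n. \<integral>\<^sup>+y. ennreal (\<Phi> (fst y) (LINT s|R. x n y s)) \<partial>(R \<Otimes>\<^sub>M M))
      \<longlonglongrightarrow> (\<integral>\<^sup>+y. ennreal (\<Phi> (fst y) (LINT s|R. x' y s)) \<partial>(R \<Otimes>\<^sub>M M))"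
  proof (rule nn_integral_dominated_convergence[OF _ _ w_meas _ w_int])
    show "AE y in R \<Otimes>\<^sub>M M. ennreal (\<Phi> (fst y) (LINT s|R. x n y s)) \<le> w y" for n
      using D_fin AE_space by eventually_elim (intro bound x_le)
    show "AE y in R \<Otimes>\<^sub>M M. (\<lambda>n. ennreal (\<Phi> (fst y) (LINT s|R. x n y s)))
        \<longlonglongrightarrow> ennreal (\<Phi> (fst y) (LINT s|R. x' y s))"
      using D_fin AE_space
    proof eventually_elim
      case (elim y)
      then have t: "fst y \<in> space R" by (auto simp: space_pair_measure)
      have [measurable]: "x' y \<in> borel_measurable R" "x n y \<in> borel_measurable R" for n
        using elim(2) by measurable
      have "(\<lambda>n. LINT s|R. x n y s) \<longlonglongrightarrow> (LINT s|R. x' y s)"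
        by (rule integral_dominated_convergence[where w = "f y"])
           (use f_int[of y] elim x_lim x_le in \<open>auto intro!: AE_I2\<close>)
      then show ?case
        by (intro tendsto_ennrealI isCont_tendsto_compose[OF \<Phi>_cont[OF t]])
    qed
  qed (intro integrand_meas x_meas x'_meas)+
  then show "(\<lambda>n. \<integral>\<^sup>+\<omega>. \<integral>\<^sup>+t. ennreal (\<Phi> t (LINT s|R. x n (t, \<omega>) s)) \<partial>R \<partial>M)
      \<longlonglongrightarrow> (\<integral>\<^sup>+\<omega>. \<integral>\<^sup>+t. ennreal (\<Phi> t (LINT s|R. x' (t, \<omega>) s)) \<partial>R \<partial>M)"
    by (simp add: iter[OF x_meas] iter[OF x'_meas])
  have "(\<integral>\<^sup>+y. ennreal (\<Phi> (fst y) (LINT s|R. x' y s)) \<partial>(R \<Otimes>\<^sub>M M)) \<le> (\<integral>\<^sup>+y. w y \<partial>(R \<Otimes>\<^sub>M M))"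
    using D_fin AE_space by (intro nn_integral_mono_AE, eventually_elim) (intro bound x'_le)
  then show "(\<integral>\<^sup>+\<omega>. \<integral>\<^sup>+t. ennreal (\<Phi> t (LINT s|R. x' (t, \<omega>) s)) \<partial>R \<partial>M) < \<infinity>"
    using w_int by (simp add: iter[OF x'_meas] order_le_less_trans)
qed

section \<open>Continuity of the cost under dominated convergence of controls\<close>

lemma integral_initial_interval:
  fixes g :: "real \<Rightarrow> real"
  assumes "t \<in> {0..T}"
  shows "(LBINT s:{0..t}. g s)
    = (LINT s|restrict_space lborel {0..T}. (if s \<le> t then g s else 0))"
  unfolding set_lebesgue_integral_def
  by (subst integral_restrict_space)
     (use assms in \<open>auto intro!: Bochner_Integration.integral_cong split: split_indicator\<close>)

text \<open>On \<open>s \<le> t\<close> the state has the kernel \<open>(G t / G s) exp (A t - A s)\<close>, where \<open>A\<close> is bounded and the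
  \<open>p\<close>-th moment of \<open>G t / G s\<close> is bounded uniformly in \<open>s \<le> t \<le> T\<close>. By independence of
  increments, the kernel times \<open>\<bar>z s\<bar> + \<bar>v s\<bar>\<close> therefore has \<open>L\<^sup>p(\<Omega>)\<close> norm at most a constant times
  \<open>h s\<close>, the \<open>L\<^sup>p(\<Omega>)\<close> norm of \<open>z s\<close> plus \<open>\<bar>v s\<bar> + 1\<close>, which is integrable in time.\<close>

theorem cost_dominated_convergence:
  fixes M :: "'a measure" and u :: "nat \<Rightarrow> real \<Rightarrow> real"
  assumes M: "filtered_prob_space M \<F>" and W: "brownian_motion M \<F> W"
    and a: "a \<in> L1_space T" and p: "p > 1"
    and z_adapted: "\<And>t. t \<in> {0..T} \<Longrightarrow> z t \<in> borel_measurable (\<F> t)"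
    and z_meas: "(\<lambda>(t, \<omega>). z t \<omega>) \<in> borel_measurable (restrict_space borel {0..T} \<Otimes>\<^sub>M M)"
    and z_Lp: "\<And>t. t \<in> {0..T} \<Longrightarrow> integrable M (\<lambda>\<omega>. \<bar>z t \<omega>\<bar> powr p)"
    and z_L1_Lp: "(\<lambda>t. (LINT \<omega>|M. \<bar>z t \<omega>\<bar> powr p) powr (1 / p)) \<in> L1_space T"
    and F_meas: "(\<lambda>(t, \<xi>). F t \<xi>) \<in> borel_measurable (restrict_space borel ({0..T} \<times> UNIV))"
    and F_cont: "\<And>t \<xi>. t \<in> {0..T} \<Longrightarrow> isCont (F t) \<xi>"
    and L: "L \<in> L1_space T" and L_nonneg: "\<And>t. t \<in> {0..T} \<Longrightarrow> L t \<ge> 0"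
    and F_growth: "\<And>t \<xi>. t \<in> {0..T} \<Longrightarrow> F t \<xi> \<le> L t * (1 + \<bar>\<xi>\<bar> powr p)"
    and u: "\<And>n. u n \<in> L1_space T" and u': "u' \<in> L1_space T" and v: "v \<in> L1_space T"
    and u_le: "\<And>n t. t \<in> {0..T} \<Longrightarrow> \<bar>u n t\<bar> \<le> \<bar>v t\<bar>"
    and u_lim: "\<And>t. t \<in> {0..T} \<Longrightarrow> (\<lambda>n. u n t) \<longlonglongrightarrow> u' t"
  shows "(\<lambda>n. cost M T a W z F (u n)) \<longlonglongrightarrow> cost M T a W z F u'"
    and "cost M T a W z F u' < \<infinity>"
proof -
  define R where "R = restrict_space lborel {0..T}"
  have space_R[simp]: "space R = {0..T}"
    by (simp add: R_def)
  have sets_R[measurable_cong]: "sets R = sets (restrict_space borel {0..T})"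
    unfolding R_def by (rule sets_restrict_space_cong) simp
  have finite_R: "finite_measure R"
    by (rule finite_measureI)
      (use emeasure_lborel_cbox_finite[of 0 T] in \<open>simp add: R_def emeasure_restrict_space\<close>)
  have prob_M: "prob_space M"
    using M by (simp add: filtered_prob_space_def)
  interpret R: finite_measure R by (rule finite_R)
  interpret M: prob_space M by (rule prob_M)
  have L1_R: "g \<in> L1_space T \<longleftrightarrow> integrable R g" for g
    by (simp add: L1_space_def R_def set_integrable_eq)
  have id_R: "(\<lambda>t. t) \<in> borel_measurable R"
    by (simp add: R_def measurable_restrict_space1)
  have [measurable]: "a \<in> borel_measurable R" "u' \<in> borel_measurable R"
      "v \<in> borel_measurable R" "u n \<in> borel_measurable R" for n
    using a u u' v by (auto simp: L1_R)
  have z_R[measurable]: "(\<lambda>y. z (fst y) (snd y)) \<in> borel_measurable (R \<Otimes>\<^sub>M M)"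
    using z_meas by (simp add: case_prod_beta' cong: measurable_cong_sets sets_pair_measure_cong)
  have F_R: "(\<lambda>(t, \<xi>). F t \<xi>) \<in> borel_measurable (R \<Otimes>\<^sub>M borel)"
  proof -
    have "(\<lambda>y. (fst y, snd y)) \<in> R \<Otimes>\<^sub>M (borel :: real measure) \<rightarrow>\<^sub>M borel"
      supply id_R[measurable] by (rule borel_measurable_Pair) measurable
    then have "(\<lambda>y. y) \<in> R \<Otimes>\<^sub>M (borel :: real measure) \<rightarrow>\<^sub>M restrict_space borel ({0..T} \<times> UNIV)"
      by (intro measurable_restrict_space2) (auto simp: space_pair_measure)
    from measurable_compose[OF this F_meas] show ?thesis .
  qed

  define A where "A = primitive a"
  have A_eq: "A t = (LINT s|R. (if s \<le> t then a s else 0))" if "t \<in> {0..T}" for t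
    unfolding A_def primitive_def R_def by (rule integral_initial_interval[OF that])
  have A_meas[measurable]: "A \<in> borel_measurable R"
  proof -
    have "(\<lambda>t. LINT s|R. (if s \<le> t then a s else 0)) \<in> borel_measurable R"
      supply id_R[measurable] by measurable
    then show ?thesis
      by (rule measurable_cong[THEN iffD2, rotated]) (simp add: A_eq)
  qed
  define K where "K = (LINT s|R. \<bar>a s\<bar>)"
  have A_bound: "\<bar>A t\<bar> \<le> K" if "t \<in> {0..T}" for t
    unfolding A_eq[OF that] K_def using a
    by (intro order_trans[OF integral_abs_bound] integral_mono')
       (auto simp: L1_R)

  obtain B where B[measurable]: "(\<lambda>(t, \<omega>). B t \<omega>) \<in> borel_measurable (borel \<Otimes>\<^sub>M M)"
    and BW: "AE \<omega> in M. \<forall>t\<ge>0. B t \<omega> = W t \<omega>"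
    using brownian_motion_modification[OF M W] .
  \<comment> \<open>The factor in front of the pathwise integral is moved under it. Extending the kernel by \<open>0\<close> to
    \<open>s > t\<close> makes every state an integral over the same space.\<close>
  define k where "k y s = (if s \<le> fst y then
      exp (B (fst y) (snd y) - fst y / 2) * exp (A (fst y)) *
      (exp (- A s) / exp (B s (snd y) - s / 2)) else 0)" for y s
  have k_meas[measurable]: "(\<lambda>(y, s). k y s) \<in> borel_measurable ((R \<Otimes>\<^sub>M M) \<Otimes>\<^sub>M R)"
    unfolding k_def supply id_R[measurable] by measurable
  have k_nonneg: "k y s \<ge> 0" for y s
    by (simp add: k_def)
  have cost_eq: "cost M T a W z F g
      = (\<integral>\<^sup>+\<omega>. \<integral>\<^sup>+t. ennreal (F t (LINT s|R. k (t, \<omega>) s * (z s \<omega> - g s))) \<partial>R \<partial>M)" for g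
    unfolding cost_def
  proof (rule nn_integral_cong_AE)
    show "AE \<omega> in M. (\<integral>\<^sup>+t\<in>{0..T}. ennreal (F t (controlled_state a W z g t \<omega>)) \<partial>lborel)
        = (\<integral>\<^sup>+t. ennreal (F t (LINT s|R. k (t, \<omega>) s * (z s \<omega> - g s))) \<partial>R)"
      using BW
    proof eventually_elim
      case (elim \<omega>)
      have "controlled_state a W z g t \<omega> = (LINT s|R. k (t, \<omega>) s * (z s \<omega> - g s))"
        if t: "t \<in> {0..T}" for t
      proof -
        have "controlled_state a W z g t \<omega> = exp (B t \<omega> - t / 2) * exp (A t) *
            (LINT s|R. (if s \<le> t then exp (- A s) / exp (W s \<omega> - s / 2) * (z s \<omega> - g s) else 0))"
          unfolding controlled_state_def integral_initial_interval[OF t] geom_bm_def A_def R_def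
          using elim t by simp
        also have "\<dots> = (LINT s|R. exp (B t \<omega> - t / 2) * exp (A t) *
            (if s \<le> t then exp (- A s) / exp (W s \<omega> - s / 2) * (z s \<omega> - g s) else 0))"
          by simp
        also have "\<dots> = (LINT s|R. k (t, \<omega>) s * (z s \<omega> - g s))"
          using elim by (intro Bochner_Integration.integral_cong) (auto simp: k_def)
        finally show ?thesis .
      qed
      then show ?case
        unfolding R_def by (subst nn_integral_restrict_space)
          (auto intro!: nn_integral_cong split: split_indicator)
    qed
  qed

  define f where "f y s = k y s * (\<bar>z s (snd y)\<bar> + \<bar>v s\<bar>)" for y s
  define h where "h s = (LINT \<omega>|M. \<bar>z s \<omega>\<bar> powr p) powr (1 / p) + \<bar>v s\<bar> + 1" for s
  \<comment> \<open>The three factors come from the drift, from the increment of \<open>W\<close>, and from splitting the power of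
    \<open>\<bar>z s\<bar> + \<bar>v s\<bar>\<close>.\<close>
  define C where "C = exp (2 * p * K) * exp (p\<^sup>2 * T / 2) * (2 powr p * 2)"
  have h_int: "integrable R h"
    unfolding h_def using z_L1_Lp v by (simp add: L1_R)
  have moment: "(\<integral>\<^sup>+\<omega>. ennreal (f (t, \<omega>) s powr p) \<partial>M) \<le> ennreal (C * h s powr p)"
    if t: "t \<in> {0..T}" and s: "s \<in> {0..T}" for t s
  proof (cases "s \<le> t")
    case st: True
    define X where "X \<omega> = (\<bar>z s \<omega>\<bar> + \<bar>v s\<bar>) powr p" for \<omega>
    have [measurable]: "z s \<in> borel_measurable (\<F> s)"
      by (rule z_adapted[OF s])
    have X_meas[measurable]: "X \<in> borel_measurable (\<F> s)"
      unfolding X_def by measurable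
    have subs: "subalgebra M (\<F> s)" "subalgebra M (\<F> t)"
      using M s t by (auto simp: filtered_prob_space_def)
    have [measurable]: "X \<in> borel_measurable M" "W t \<in> borel_measurable M" "W s \<in> borel_measurable M"
      using W s t
      by (auto intro!: measurable_from_subalg[OF subs(1) X_meas] measurable_from_subalg[OF subs(1), of "W s"]
            measurable_from_subalg[OF subs(2), of "W t"] simp: brownian_motion_def)
    have EX: "(\<integral>\<^sup>+\<omega>. ennreal (X \<omega>) \<partial>M) \<le> ennreal (2 powr p * 2 * h s powr p)"
    proof -
      have "(\<integral>\<^sup>+\<omega>. ennreal (X \<omega>) \<partial>M)
          \<le> (\<integral>\<^sup>+\<omega>. ennreal (2 powr p * (\<bar>z s \<omega>\<bar> powr p + \<bar>v s\<bar> powr p)) \<partial>M)"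
        unfolding X_def using p by (intro nn_integral_mono ennreal_leI powr_add_le) auto
      also have "\<dots> = ennreal (2 powr p * ((LINT \<omega>|M. \<bar>z s \<omega>\<bar> powr p) + \<bar>v s\<bar> powr p))"
        using z_Lp[OF s] by (subst nn_integral_eq_integral) (auto simp: M.prob_space)
      also have "\<dots> \<le> ennreal (2 powr p * (h s powr p + h s powr p))"
      proof (intro ennreal_leI mult_left_mono add_mono)
        have E: "(LINT \<omega>|M. \<bar>z s \<omega>\<bar> powr p) \<ge> 0"
          by (intro integral_nonneg_AE AE_I2) auto
        then have "(LINT \<omega>|M. \<bar>z s \<omega>\<bar> powr p) = ((LINT \<omega>|M. \<bar>z s \<omega>\<bar> powr p) powr (1 / p)) powr p"
          using p by (simp add: powr_powr)
        also have "\<dots> \<le> h s powr p"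
          using p by (intro powr_mono2) (auto simp: h_def)
        finally show "(LINT \<omega>|M. \<bar>z s \<omega>\<bar> powr p) \<le> h s powr p" .
        show "\<bar>v s\<bar> powr p \<le> h s powr p"
          using p by (intro powr_mono2) (auto simp: h_def)
      qed auto
      finally show ?thesis by (simp add: mult.assoc)
    qed
    have "(\<integral>\<^sup>+\<omega>. ennreal (f (t, \<omega>) s powr p) \<partial>M)
        \<le> (\<integral>\<^sup>+\<omega>. ennreal (exp (2 * p * K)) * (ennreal (X \<omega>) * ennreal (exp (p * (W t \<omega> - W s \<omega>)))) \<partial>M)"
      using BW
    proof (intro nn_integral_mono_AE, eventually_elim)
      case (elim \<omega>)
      have k_eq: "k (t, \<omega>) s = exp (W t \<omega> - W s \<omega> + (A t - A s - (t - s) / 2))"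
        using elim st s t by (simp add: k_def flip: exp_add exp_diff) (simp add: field_simps)
      have "f (t, \<omega>) s powr p
          = exp (p * (A t - A s - (t - s) / 2)) * (X \<omega> * exp (p * (W t \<omega> - W s \<omega>)))"
        by (simp add: f_def k_eq X_def powr_mult exp_powr_real) (simp add: ring_distribs exp_add mult_ac)
      also have "\<dots> \<le> exp (2 * p * K) * (X \<omega> * exp (p * (W t \<omega> - W s \<omega>)))"
      proof (intro mult_right_mono)
        have "A t - A s - (t - s) / 2 \<le> 2 * K"
          using A_bound[OF s] A_bound[OF t] st by (simp add: field_simps abs_le_iff)
        then have "p * (A t - A s - (t - s) / 2) \<le> p * (2 * K)"
          using p by (intro mult_left_mono) auto
        then show "exp (p * (A t - A s - (t - s) / 2)) \<le> exp (2 * p * K)"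
          by (simp add: mult_ac)
      qed (simp add: X_def)
      finally show ?case
        by (simp add: X_def flip: ennreal_mult)
    qed
    also have "\<dots> = ennreal (exp (2 * p * K)) *
        (\<integral>\<^sup>+\<omega>. ennreal (X \<omega>) * ennreal (exp (p * (W t \<omega> - W s \<omega>))) \<partial>M)"
      by (rule nn_integral_cmult) measurable
    also have "(\<integral>\<^sup>+\<omega>. ennreal (X \<omega>) * ennreal (exp (p * (W t \<omega> - W s \<omega>))) \<partial>M)
        = ennreal (exp (p\<^sup>2 * (t - s) / 2)) * (\<integral>\<^sup>+\<omega>. ennreal (X \<omega>) \<partial>M)"
      using s st by (intro brownian_increment_exp_moment[OF M W]) auto
    also have "\<dots> \<le> ennreal (exp (p\<^sup>2 * T / 2)) * ennreal (2 powr p * 2 * h s powr p)"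
      using s t by (intro mult_mono EX ennreal_leI) (auto intro!: mult_left_mono)
    finally show ?thesis
      by (simp add: C_def mult_left_mono mult.assoc flip: ennreal_mult)
  qed (use p in \<open>simp add: f_def k_def\<close>)

  define x where "x g y s = k y s * (z s (snd y) - g s)" for g y s
  have k_pair: "(\<lambda>q. k (fst q) (snd q)) \<in> borel_measurable ((R \<Otimes>\<^sub>M M) \<Otimes>\<^sub>M R)"
    using k_meas by (simp add: case_prod_beta')
  have z_pair: "(\<lambda>q. z (snd q) (snd (fst q))) \<in> borel_measurable ((R \<Otimes>\<^sub>M M) \<Otimes>\<^sub>M R)"
    using measurable_compose[OF measurable_Pair[OF measurable_snd
        measurable_compose[OF measurable_fst measurable_snd]] z_R] by simp
  have control_pair: "(\<lambda>q. g (snd q)) \<in> borel_measurable ((R \<Otimes>\<^sub>M M) \<Otimes>\<^sub>M R)"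
    if "g \<in> borel_measurable R" for g :: "real \<Rightarrow> real"
    by (rule measurable_compose[OF measurable_snd that])
  have x_meas: "(\<lambda>(y, s). x g y s) \<in> borel_measurable ((R \<Otimes>\<^sub>M M) \<Otimes>\<^sub>M R)"
    if "g \<in> borel_measurable R" for g
    unfolding x_def case_prod_beta'
    by (intro borel_measurable_times borel_measurable_diff k_pair z_pair control_pair that)
  have f_meas: "(\<lambda>(y, s). f y s) \<in> borel_measurable ((R \<Otimes>\<^sub>M M) \<Otimes>\<^sub>M R)"
    unfolding f_def case_prod_beta'
    by (intro borel_measurable_times borel_measurable_add borel_measurable_abs
        k_pair z_pair control_pair) measurable
  have x_le: "\<bar>x (u n) y s\<bar> \<le> f y s" if "s \<in> {0..T}" for n y s
    using u_le[OF that, of n] k_nonneg[of y s]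
    by (auto simp: x_def f_def abs_mult intro!: mult_left_mono)
  have x_lim: "(\<lambda>n. x (u n) y s) \<longlonglongrightarrow> x u' y s" if "s \<in> {0..T}" for y s
    unfolding x_def by (intro tendsto_intros u_lim that)
  have C: "C \<ge> 0" by (simp add: C_def)
  have h_pos: "h s > 0" for s
    unfolding h_def by (auto intro!: add_nonneg_pos)
  have f_nonneg: "f y s \<ge> 0" for y s
    unfolding f_def using k_nonneg[of y s] by simp
  have L_R: "integrable R L" using L by (simp add: L1_R)
  have lim: "(\<lambda>n. \<integral>\<^sup>+\<omega>. \<integral>\<^sup>+t. ennreal (F t (LINT s|R. x (u n) (t, \<omega>) s)) \<partial>R \<partial>M)
      \<longlonglongrightarrow> (\<integral>\<^sup>+\<omega>. \<integral>\<^sup>+t. ennreal (F t (LINT s|R. x u' (t, \<omega>) s)) \<partial>R \<partial>M)"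
    and fin: "(\<integral>\<^sup>+\<omega>. \<integral>\<^sup>+t. ennreal (F t (LINT s|R. x u' (t, \<omega>) s)) \<partial>R \<partial>M) < \<infinity>"
    using nested_integral_dominated_convergence[of R M p C f h L F "\<lambda>n. x (u n)" "x u'"]
      finite_R prob_M p C f_meas f_nonneg h_int h_pos moment L_R L_nonneg F_R F_cont F_growth
      x_meas x_le x_lim by auto
  show "(\<lambda>n. cost M T a W z F (u n)) \<longlonglongrightarrow> cost M T a W z F u'"
    and "cost M T a W z F u' < \<infinity>"
    using lim fin by (simp_all add: cost_eq x_def)
qed

section \<open>Minimizers of the regularized costs\<close>

text \<open>The density \<open>\<psi>\<close> is non-decreasing, so \<open>r * \<psi> r\<close> serves as the bound on \<open>[0, r]\<close>.\<close>

lemma young_function_locally_bounded: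
  assumes "young_function \<Psi>"
  obtains c :: "real \<Rightarrow> real" where "\<And>r t. 0 \<le> t \<Longrightarrow> t \<le> r \<Longrightarrow> \<Psi> t \<le> c r"
proof -
  obtain \<psi> where \<psi>: "\<psi> 0 = 0" "\<forall>s>0. \<psi> s > 0" "mono_on {0..} \<psi>"
      and \<Psi>: "\<forall>t\<ge>0. \<Psi> t = (LBINT s:{0..t}. \<psi> s)"
    using assms by (auto simp: young_function_def)
  have "\<Psi> t \<le> r * \<psi> r" if "0 \<le> t" "t \<le> r" for r t
  proof -
    have \<psi>r: "0 \<le> \<psi> r"
      using \<psi> that by (cases "r = 0") (auto intro: less_imp_le)
    \<comment> \<open>The bound holds in either case, since a non-integrable density would give \<open>0\<close> by
      convention.\<close>
    show ?thesis
    proof (cases "set_integrable lborel {0..t} \<psi>")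
      case True
      have "\<Psi> t \<le> (LBINT s:{0..t}. \<psi> r)"
        using that \<Psi> True \<psi>(3)
        by (auto intro!: set_integral_mono borel_integrable_atLeastAtMost' continuous_intros
            simp: mono_on_def)
      also have "\<dots> = t * \<psi> r"
        using that by (simp add: set_lebesgue_integral_def)
      also have "\<dots> \<le> r * \<psi> r"
        using that \<psi>r by (intro mult_right_mono)
      finally show ?thesis .
    next
      case False
      then have "\<Psi> t = 0"
        using that \<Psi> by (simp add: set_integrable_def set_lebesgue_integral_def not_integrable_integral_eq)
      then show ?thesis
        using that \<psi>r by simp
    qed
  qed
  then show thesis
    by (intro that[of "\<lambda>r. r * \<psi> r"])
qed

lemma young_penalty_bounded_control:
  assumes \<Psi>: "young_function \<Psi>" and u: "\<And>t. \<bar>u t\<bar> \<le> r"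
  shows "young_penalty T \<Psi> u < \<infinity>"
proof -
  obtain c :: "real \<Rightarrow> real" where c: "\<And>r t. 0 \<le> t \<Longrightarrow> t \<le> r \<Longrightarrow> \<Psi> t \<le> c r"
    using young_function_locally_bounded[OF \<Psi>] by blast
  have "young_penalty T \<Psi> u \<le> (\<integral>\<^sup>+t\<in>{0..T}. ennreal (c r) \<partial>lborel)"
    unfolding young_penalty_def
    by (intro nn_integral_mono mult_right_mono ennreal_leI c u) auto
  also have "\<dots> = ennreal (c r) * emeasure lborel {0..T}"
    by (rule nn_integral_cmult_indicator) simp
  also have "\<dots> < \<infinity>"
    using emeasure_lborel_cbox_finite[of 0 T] by (simp add: ennreal_mult_less_top less_top)
  finally show ?thesis .
qed

theorem theorem5p10:
  fixes M :: "'a measure"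
    and \<F> :: "real \<Rightarrow> 'a measure"
    and W z :: "real \<Rightarrow> 'a \<Rightarrow> real"
    and T p \<alpha> :: real
    and a L \<Psi> :: "real \<Rightarrow> real"
    and F F\<^sub>\<xi> F\<^sub>\<xi>\<^sub>\<xi> :: "real \<Rightarrow> real \<Rightarrow> real"
    and ubar :: "real \<Rightarrow> real \<Rightarrow> real"
  assumes T: "T > 0"
    and M: "filtered_prob_space M \<F>"
    and W: "brownian_motion M \<F> W"
    and a: "a \<in> Linf_space T"
    and z_adapted: "\<And>t. t \<in> {0..T} \<Longrightarrow> z t \<in> borel_measurable (\<F> t)"
    and z_measurable:
      "(\<lambda>(t, \<omega>). z t \<omega>) \<in> borel_measurable (restrict_space borel {0..T} \<Otimes>\<^sub>M M)"
    and p: "p \<ge> 2"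
    and z_Lp: "\<And>t. t \<in> {0..T} \<Longrightarrow> integrable M (\<lambda>\<omega>. \<bar>z t \<omega>\<bar> powr p)"
    and z_L2_Lp:
      "(\<integral>\<^sup>+t\<in>{0..T}. ennreal ((LINT \<omega>|M. \<bar>z t \<omega>\<bar> powr p) powr (2 / p)) \<partial>lborel) < \<infinity>"
    and F_measurable:
      "(\<lambda>(t, \<xi>). F t \<xi>) \<in> borel_measurable (restrict_space borel ({0..T} \<times> UNIV))"
    and F_nonneg: "\<And>t \<xi>. t \<in> {0..T} \<Longrightarrow> F t \<xi> \<ge> 0"
    and F_deriv: "\<And>t \<xi>. t \<in> {0..T} \<Longrightarrow> (F t has_real_derivative F\<^sub>\<xi> t \<xi>) (at \<xi>)"
    and F_deriv2: "\<And>t \<xi>. t \<in> {0..T} \<Longrightarrow> (F\<^sub>\<xi> t has_real_derivative F\<^sub>\<xi>\<^sub>\<xi> t \<xi>) (at \<xi>)"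
    and F_deriv_cont: "continuous_on ({0..T} \<times> UNIV) (\<lambda>(t, \<xi>). F\<^sub>\<xi> t \<xi>)"
    and F_deriv2_cont: "continuous_on ({0..T} \<times> UNIV) (\<lambda>(t, \<xi>). F\<^sub>\<xi>\<^sub>\<xi> t \<xi>)"
    and \<alpha>: "0 < \<alpha>" "\<alpha> < p"
    and L: "L \<in> L1_space T" "\<And>t. t \<in> {0..T} \<Longrightarrow> L t \<ge> 0"
    and F_growth: "\<And>t \<xi>. t \<in> {0..T} \<Longrightarrow>
      \<bar>F t \<xi>\<bar> + \<bar>F\<^sub>\<xi> t \<xi>\<bar> + \<bar>F\<^sub>\<xi>\<^sub>\<xi> t \<xi>\<bar> \<le> L t * (1 + \<bar>\<xi>\<bar> powr \<alpha>)"
    and F_convex: "\<And>t. t \<in> {0..T} \<Longrightarrow> convex_on UNIV (F t)"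
    and \<Psi>: "young_function \<Psi>" "Delta2 \<Psi>"
    and ubar: "\<And>\<delta>. \<delta> > 0 \<Longrightarrow>
      is_arg_min (regularized_cost M T a W z F \<delta> \<Psi>) (\<lambda>u. u \<in> L1_space T) (ubar \<delta>)"
  defines "m \<equiv> (INF u\<in>L1_space T. cost M T a W z F u)"
  shows "\<forall>\<epsilon>::real. \<epsilon> > 0 \<longrightarrow> (\<exists>\<delta>\<^sub>0>0. \<forall>\<delta>. 0 < \<delta> \<and> \<delta> < \<delta>\<^sub>0 \<longrightarrow>
           m \<le> cost M T a W z F (ubar \<delta>) \<and> cost M T a W z F (ubar \<delta>) \<le> m + ennreal \<epsilon>)"
proof -
  let ?J = "cost M T a W z F"
  have a_L1: "a \<in> L1_space T"
  proof -
    obtain C where C: "AE t in lborel. t \<in> {0..T} \<longrightarrow> \<bar>a t\<bar> \<le> C"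
      and a_meas: "set_borel_measurable lborel {0..T} a"
      using a by (auto simp: Linf_space_def)
    have "set_integrable lborel {0..T} (\<lambda>_. C)"
      by (intro borel_integrable_atLeastAtMost' continuous_intros)
    then show ?thesis
      unfolding L1_space_def set_integrable_def mem_Collect_eq
      by (rule Bochner_Integration.integrable_bound)
         (use a_meas C in \<open>auto simp: set_borel_measurable_def split: split_indicator elim: eventually_mono\<close>)
  qed
  \<comment> \<open>On a bounded time interval square integrability of the \<open>L\<^sup>p(\<Omega>)\<close> norm gives integrability,
    through \<open>r \<le> 1 + r\<^sup>2\<close>.\<close>
  have z_L1_Lp: "(\<lambda>t. (LINT \<omega>|M. \<bar>z t \<omega>\<bar> powr p) powr (1 / p)) \<in> L1_space T"
  proof -
    interpret prob_space M
      using M by (simp add: filtered_prob_space_def)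
    define R where "R = restrict_space lborel {0..T}"
    define e where "e t = (LINT \<omega>|M. \<bar>z t \<omega>\<bar> powr p)" for t
    have sets_R[measurable_cong]: "sets R = sets (restrict_space borel {0..T})"
      unfolding R_def by (rule sets_restrict_space_cong) simp
    have [measurable]: "(\<lambda>y. z (fst y) (snd y)) \<in> borel_measurable (R \<Otimes>\<^sub>M M)"
      using z_measurable by (simp add: case_prod_beta' cong: measurable_cong_sets sets_pair_measure_cong)
    have e_meas[measurable]: "e \<in> borel_measurable R"
      unfolding e_def by measurable
    have e: "e t \<ge> 0" for t
      unfolding e_def by (intro integral_nonneg_AE AE_I2) auto
    have "(\<integral>\<^sup>+t. ennreal (e t powr (2 / p)) \<partial>R) < \<infinity>"
      using z_L2_Lp unfolding R_def e_def by (subst nn_integral_restrict_space) auto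
    then have sq: "integrable R (\<lambda>t. e t powr (2 / p))"
      by (intro integrableI_nonneg) auto
    have "finite_measure R"
      by (rule finite_measureI)
         (use emeasure_lborel_cbox_finite[of 0 T] in \<open>simp add: R_def emeasure_restrict_space\<close>)
    then have one_sq: "integrable R (\<lambda>t. 1 + e t powr (2 / p))"
      by (intro Bochner_Integration.integrable_add sq finite_measure.integrable_const)
    have le: "e t powr (1 / p) \<le> 1 + e t powr (2 / p)" for t
    proof -
      have "e t powr (2 / p) = (e t powr (1 / p))\<^sup>2"
        by (simp add: power2_eq_square flip: powr_add add_divide_distrib)
      moreover have "0 \<le> (e t powr (1 / p) - 1)\<^sup>2" "0 \<le> e t powr (1 / p)" by simp_all
      ultimately show ?thesis
        unfolding power2_diff by (simp; linarith)
    qed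
    have "integrable R (\<lambda>t. e t powr (1 / p))"
      using le by (intro Bochner_Integration.integrable_bound[OF one_sq]) (auto intro!: AE_I2)
    then show ?thesis
      by (simp add: L1_space_def set_integrable_eq R_def e_def)
  qed
  have L2: "(\<lambda>t. 2 * L t) \<in> L1_space T"
    using L(1) by (simp add: L1_space_def)
  \<comment> \<open>Raising the exponent from \<open>\<alpha>\<close> to \<open>p\<close> costs a factor \<open>2\<close>, because \<open>r powr \<alpha> \<le> 1 + r powr p\<close>.\<close>
  have growth: "F t \<xi> \<le> 2 * L t * (1 + \<bar>\<xi>\<bar> powr p)" if t: "t \<in> {0..T}" for t \<xi>
  proof -
    have "\<bar>\<xi>\<bar> powr \<alpha> \<le> 1 + \<bar>\<xi>\<bar> powr p"
    proof (cases "\<bar>\<xi>\<bar> \<le> 1")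
      case True
      then have "\<bar>\<xi>\<bar> powr \<alpha> \<le> 1"
        using \<alpha> by (intro powr_le1) auto
      then show ?thesis
        by (simp add: add_increasing2)
    next
      case False
      then have "\<bar>\<xi>\<bar> powr \<alpha> \<le> \<bar>\<xi>\<bar> powr p"
        using \<alpha> by (intro powr_mono) auto
      then show ?thesis by simp
    qed
    have "1 + \<bar>\<xi>\<bar> powr \<alpha> \<le> 2 * (1 + \<bar>\<xi>\<bar> powr p)"
    proof -
      have "1 + b \<le> 2 * (1 + c)" if "b \<le> 1 + c" "0 \<le> c" for b c :: real
        using that by simp
      then show ?thesis
        using \<open>\<bar>\<xi>\<bar> powr \<alpha> \<le> 1 + \<bar>\<xi>\<bar> powr p\<close> powr_ge_zero by blast
    qed
    then have "L t * (1 + \<bar>\<xi>\<bar> powr \<alpha>) \<le> L t * (2 * (1 + \<bar>\<xi>\<bar> powr p))"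
      using L(2)[OF t] by (intro mult_left_mono)
    then show ?thesis
      using F_growth[OF t, of \<xi>] by (simp add: algebra_simps)
  qed
  have cont: "isCont (F t) \<xi>" if "t \<in> {0..T}" for t \<xi>
    using F_deriv[OF that] by (rule DERIV_isCont)
  have p1: "p > 1" using p by simp
  note convergence = cost_dominated_convergence[OF M W a_L1 p1 z_adapted z_measurable z_Lp
      z_L1_Lp F_measurable cont L2 _ growth]
  define trunc where "trunc u n t = (if \<bar>u t\<bar> \<le> real n then u t else 0)"
    for u :: "real \<Rightarrow> real" and n t
  have trunc_L1: "trunc u n \<in> L1_space T" if "u \<in> L1_space T" for u n
  proof -
    have int: "integrable lborel (\<lambda>t. indicator {0..T} t * u t)"
      using that by (simp add: L1_space_def set_integrable_def)
    have eq: "indicator {0..T} t * trunc u n t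
        = (if \<bar>indicator {0..T} t * u t\<bar> \<le> real n then indicator {0..T} t * u t else 0)" for t
      by (auto simp: trunc_def split: split_indicator)
    have [measurable]: "(\<lambda>t. indicator {0..T} t * u t) \<in> borel_measurable lborel"
      using int by simp
    have "integrable lborel (\<lambda>t. indicator {0..T} t * trunc u n t)"
      unfolding eq by (rule Bochner_Integration.integrable_bound[OF int]) auto
    then show ?thesis
      by (simp add: L1_space_def set_integrable_def)
  qed
  have trunc_lim: "(\<lambda>n. trunc u n t) \<longlonglongrightarrow> u t" for u t
  proof (rule tendsto_eventually)
    obtain N where "\<bar>u t\<bar> \<le> real N" using real_arch_simple by blast
    then show "eventually (\<lambda>n. trunc u n t = u t) sequentially"
      unfolding eventually_sequentially by (intro exI[of _ N]) (auto simp: trunc_def)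
  qed
  have trunc_conv: "(\<lambda>n. ?J (trunc u n)) \<longlonglongrightarrow> ?J u"
    and J_fin: "?J u < \<infinity>" if "u \<in> L1_space T" for u
    using convergence[of "trunc u" u u] that L(2) trunc_L1[OF that] trunc_lim
    by (auto simp: trunc_def)
  show ?thesis
  proof (intro allI impI)
    fix \<epsilon> :: real assume \<epsilon>: "\<epsilon> > 0"
    have m_le: "m \<le> ?J u" if "u \<in> L1_space T" for u
      unfolding m_def using that by (rule INF_lower)
    have "m < \<infinity>"
      using m_le[of "\<lambda>_. 0"] J_fin[of "\<lambda>_. 0"] by (simp add: L1_space_def set_integrable_def)
    then have "m < m + ennreal (\<epsilon> / 2)"
      using \<epsilon> by (cases m) (auto simp: ennreal_less_iff simp flip: ennreal_plus)
    then obtain u where u: "u \<in> L1_space T" "?J u < m + ennreal (\<epsilon> / 2)"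
      unfolding m_def INF_less_iff by auto
    have "eventually (\<lambda>n. ?J (trunc u n) < m + ennreal (\<epsilon> / 2)) sequentially"
      using trunc_conv[OF u(1)] u(2) by (rule order_tendstoD)
    then obtain n where n: "?J (trunc u n) < m + ennreal (\<epsilon> / 2)"
      by (auto simp: eventually_sequentially)
    have "young_penalty T \<Psi> (trunc u n) < \<infinity>"
      by (rule young_penalty_bounded_control[OF \<Psi>(1), of _ "real n"]) (simp add: trunc_def)
    then obtain P where P: "P \<ge> 0" "young_penalty T \<Psi> (trunc u n) = ennreal P"
      by (cases "young_penalty T \<Psi> (trunc u n)") auto
    \<comment> \<open>Chosen so that \<open>\<delta> * P \<le> \<epsilon> / 2\<close> below; the summand \<open>1\<close> allows \<open>P = 0\<close>.\<close>
    define \<delta>\<^sub>0 where "\<delta>\<^sub>0 = \<epsilon> / 2 / (P + 1)"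
    show "\<exists>\<delta>\<^sub>0>0. \<forall>\<delta>. 0 < \<delta> \<and> \<delta> < \<delta>\<^sub>0 \<longrightarrow> m \<le> ?J (ubar \<delta>) \<and> ?J (ubar \<delta>) \<le> m + ennreal \<epsilon>"
    proof (intro exI[of _ \<delta>\<^sub>0] conjI allI impI)
      show "\<delta>\<^sub>0 > 0"
        using \<epsilon> P by (simp add: \<delta>\<^sub>0_def)
      fix \<delta> assume \<delta>: "0 < \<delta> \<and> \<delta> < \<delta>\<^sub>0"
      have min: "ubar \<delta> \<in> L1_space T"
        "regularized_cost M T a W z F \<delta> \<Psi> (ubar \<delta>) \<le> regularized_cost M T a W z F \<delta> \<Psi> g"
        if "g \<in> L1_space T" for g
        using ubar[of \<delta>] \<delta> that by (auto simp: is_arg_min_def not_less)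
      show "m \<le> ?J (ubar \<delta>)"
        by (rule m_le[OF min(1)[OF u(1)]])
      have "\<delta> * P \<le> \<epsilon> / 2"
      proof -
        have "\<delta> * P \<le> \<delta>\<^sub>0 * (P + 1)"
          using \<delta> P by (intro mult_mono) auto
        also have "\<dots> = \<epsilon> / 2"
          using P unfolding \<delta>\<^sub>0_def by (subst nonzero_eq_divide_eq[symmetric]) auto
        finally show ?thesis .
      qed
      have "?J (ubar \<delta>) \<le> regularized_cost M T a W z F \<delta> \<Psi> (ubar \<delta>)"
        by (simp add: regularized_cost_def)
      also have "\<dots> \<le> regularized_cost M T a W z F \<delta> \<Psi> (trunc u n)"
        by (rule min(2)[OF trunc_L1[OF u(1)]])
      also have "\<dots> = ?J (trunc u n) + ennreal (\<delta> * P)"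
        using \<delta> P by (simp add: regularized_cost_def ennreal_mult)
      also have "\<dots> \<le> (m + ennreal (\<epsilon> / 2)) + ennreal (\<epsilon> / 2)"
        using n \<open>\<delta> * P \<le> \<epsilon> / 2\<close> by (intro add_mono ennreal_leI) auto
      also have "\<dots> = m + ennreal \<epsilon>"
        using \<epsilon> by (simp add: add.assoc flip: ennreal_plus)
      finally show "?J (ubar \<delta>) \<le> m + ennreal \<epsilon>" .
    qed
  qed
qed

end
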